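(* Let $F$ be an arbitrary field. There exists a finitely generated unital associative $F$-algebra $A$ such that $A$ is not linear sofic, $A$ satisfies a polynomial identity, and $A$ is (thus) stably finite.
   Context: Algebras are associative but not necessarily commutative. For a matrix $P\in M_n(F)$, $\mathrm{rk}(P)$ denotes its rank. Linear soficity: let $\mathcal{U}$ be a non-principal ultrafilter on $\mathbb{N}$ and $(n_k)_k$ a sequence of natural numbers tending to infinity. Define the asymptotic rank function $\rho_{\mathcal U}\colon \prod_k M_{n_k}(F)\to[0,1]$ by $\rho_{\mathcal U}((A_k)_k)=\lim_{k\to\mathcal U}\frac{1}{n_k}\mathrm{rk}(A_k)$ (limit along the ultrafilter). The set $\mathrm{Ker}(\rho_{\mathcal U})=\{(A_k)_k:\rho_{\mathcal U}((A_k)_k)=0\}$ is a two-sided ideal, and the quotient algebra $\prod_{k\to\mathcal U}M_{n_k}(F)/\mathrm{Ker}(\rho_{\mathcal U}):=\left(\prod_k M_{n_k}(F)\right)/\mathrm{Ker}(\rho_{\mathcal U})$ is called the metric ultraproduct. A countably generated $F$-algebra $A$ is linear sofic if, for some such $\mathcal U$ and $(n_k)_k$, there exists an injective $F$-algebra homomorphism (not required to preserve units) $\Phi\colon A\to\prod_{k\to\mathcal U}M_{n_k}(F)/\mathrm{Ker}(\rho_{\mathcal U})$. A unital ring $R$ is directly finite if $xy=1$ implies $yx=1$ for all $x,y\in R$; it is stably finite if $M_n(R)$ is directly finite for every $n\in\mathbb{N}$. An $F$-algebra $A$ satisfies a polynomial identity if there are $m\ge 1$ and a non-zero polynomial $f(X_1,\dots,X_m)$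 in the free associative algebra $F\langle X_1,\dots,X_m\rangle$ such that $f(a_1,\dots,a_m)=0$ for all $a_1,\dots,a_m\in A$. *)

theory Defs
  imports "HOL-Algebra.QuotRing" "HOL-Library.Poly_Mapping" "Jordan_Normal_Form.DL_Rank"
begin

section \<open>Associative algebras over a field\<close>

text \<open>
  The library locale \<open>algebra\<close> requires a commutative multiplication, so the axioms are restated
  for an arbitrary ring. The scalars form a type of class \<open>field\<close>, viewed as a ring record through
  \<^const>\<open>class_ring\<close>. Algebras are records with an explicit carrier.
\<close>

locale assoc_algebra = Module.module "class_ring :: 'f ring" A + A: ring A
  for A :: "('f::field, 'a, 'm) module_scheme" (structure) +
  assumes smult_mult_left:
      "\<lbrakk>x \<in> carrier A; y \<in> carrier A\<rbrakk> \<Longrightarrow> (c \<odot> x) \<otimes> y = c \<odot> (x \<otimes> y)"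
    and smult_mult_right:
      "\<lbrakk>x \<in> carrier A; y \<in> carrier A\<rbrakk> \<Longrightarrow> x \<otimes> (c \<odot> y) = c \<odot> (x \<otimes> y)"

inductive_set generate_algebra :: "('f, 'a, 'm) module_scheme \<Rightarrow> 'a set \<Rightarrow> 'a set"
  for A (structure) and S where
  one: "\<one> \<in> generate_algebra A S"
| incl: "x \<in> S \<Longrightarrow> x \<in> generate_algebra A S"
| add: "\<lbrakk>x \<in> generate_algebra A S; y \<in> generate_algebra A S\<rbrakk> \<Longrightarrow> x \<oplus> y \<in> generate_algebra A S"
| mult: "\<lbrakk>x \<in> generate_algebra A S; y \<in> generate_algebra A S\<rbrakk> \<Longrightarrow> x \<otimes> y \<in> generate_algebra A S"
| smult: "x \<in> generate_algebra A S \<Longrightarrow> c \<odot> x \<in> generate_algebra A S"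

text \<open>
  A finitely generated algebra has a basis consisting of words in its generators. Up to isomorphism
  its elements are thus coefficient functions on words, so an existence statement for finitely
  generated algebras loses no generality by taking the carrier in the type \<^typ>\<open>nat list \<Rightarrow> 'f\<close>.
\<close>

definition finitely_generated_algebra :: "('f, 'a, 'm) module_scheme \<Rightarrow> bool" where
  "finitely_generated_algebra A \<longleftrightarrow>
     (\<exists>S. finite S \<and> S \<subseteq> carrier A \<and> generate_algebra A S = carrier A)"

text \<open>Homomorphisms need not preserve the unit.\<close>

definition algebra_hom ::
  "('f::field, 'a, 'm) module_scheme \<Rightarrow> ('f, 'b, 'n) module_scheme \<Rightarrow> ('a \<Rightarrow> 'b) set" where
  "algebra_hom A B =
     {h \<in> LinearCombinations.module_hom class_ring A B.
        \<forall>x\<in>carrier A. \<forall>y\<in>carrier A. h (x \<otimes>\<^bsub>A\<^esub> y) = h x \<otimes>\<^bsub>B\<^esub> h y}"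

text \<open>The library quotient \<^const>\<open>FactRing\<close> has no scalar multiplication; here it is added on cosets.\<close>

definition quotient_algebra ::
  "('f, 'a, 'm) module_scheme \<Rightarrow> 'a set \<Rightarrow> ('f, 'a set) module" where
  "quotient_algebra A I =
     \<lparr>carrier = carrier (A Quot I), mult = mult (A Quot I), one = one (A Quot I),
      zero = zero (A Quot I), add = add (A Quot I),
      smult = (\<lambda>c X. \<Union>x\<in>X. I +>\<^bsub>A\<^esub> (c \<odot>\<^bsub>A\<^esub> x))\<rparr>"


section \<open>Linear soficity\<close>

definition nonprincipal_ultrafilter :: "'i filter \<Rightarrow> bool" where
  "nonprincipal_ultrafilter U \<longleftrightarrow>
     U \<noteq> bot \<and> (\<forall>P. eventually P U \<or> eventually (\<lambda>k. \<not> P k) U) \<and>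
     (\<forall>j. \<not> eventually (\<lambda>k. k = j) U)"

definition matrix_product :: "(nat \<Rightarrow> nat) \<Rightarrow> ('f::field, nat \<Rightarrow> 'f mat) module" where
  "matrix_product n =
     \<lparr>carrier = {P. \<forall>k. P k \<in> carrier_mat (n k) (n k)},
      mult = (\<lambda>P Q k. P k * Q k), one = (\<lambda>k. 1\<^sub>m (n k)),
      zero = (\<lambda>k. 0\<^sub>m (n k) (n k)), add = (\<lambda>P Q k. P k + Q k),
      smult = (\<lambda>c P k. c \<cdot>\<^sub>m P k)\<rparr>"

text \<open>
  The limit along an ultrafilter is \<^const>\<open>Lim\<close> along it as a filter; it exists because the
  normalised ranks lie in the compact interval from 0 to 1. The first argument of
  \<^const>\<open>vec_space.rank\<close> is the number of rows.
\<close>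

definition asymptotic_rank ::
  "nat filter \<Rightarrow> (nat \<Rightarrow> nat) \<Rightarrow> (nat \<Rightarrow> 'f::field mat) \<Rightarrow> real" where
  "asymptotic_rank U n P = Lim U (\<lambda>k. real (vec_space.rank (n k) (P k)) / real (n k))"

definition asymptotic_rank_kernel ::
  "nat filter \<Rightarrow> (nat \<Rightarrow> nat) \<Rightarrow> (nat \<Rightarrow> 'f::field mat) set" where
  "asymptotic_rank_kernel U n = {P \<in> carrier (matrix_product n). asymptotic_rank U n P = 0}"

definition metric_ultraproduct ::
  "nat filter \<Rightarrow> (nat \<Rightarrow> nat) \<Rightarrow> ('f::field, (nat \<Rightarrow> 'f mat) set) module" where
  "metric_ultraproduct U n = quotient_algebra (matrix_product n) (asymptotic_rank_kernel U n)"

text \<open>The notion is meant for countably generated algebras; this is not part of the predicate.\<close>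

definition linear_sofic :: "('f::field, 'a, 'm) module_scheme \<Rightarrow> bool" where
  "linear_sofic A \<longleftrightarrow>
     (\<exists>U n. nonprincipal_ultrafilter U \<and> (\<forall>k. 0 < n k) \<and> filterlim n at_top sequentially \<and>
        (\<exists>\<Phi> \<in> algebra_hom A (metric_ultraproduct U n). inj_on \<Phi> (carrier A)))"


section \<open>Stable finiteness\<close>

definition directly_finite :: "('a, 'm) ring_scheme \<Rightarrow> bool" where
  "directly_finite R \<longleftrightarrow>
     (\<forall>x\<in>carrier R. \<forall>y\<in>carrier R. x \<otimes>\<^bsub>R\<^esub> y = \<one>\<^bsub>R\<^esub> \<longrightarrow> y \<otimes>\<^bsub>R\<^esub> x = \<one>\<^bsub>R\<^esub>)"

text \<open>
  The \<open>n \<times> n\<close> matrices over a ring record. The library's \<^const>\<open>ring_mat\<close> is tied to the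
  type-class operations of the entries, so only its type of matrices is reused.
\<close>

definition matrix_ring :: "nat \<Rightarrow> ('a, 'm) ring_scheme \<Rightarrow> 'a mat ring" where
  "matrix_ring n R =
     \<lparr>carrier = {M \<in> carrier_mat n n. elements_mat M \<subseteq> carrier R},
      mult = (\<lambda>M N. mat n n (\<lambda>(i, j). \<Oplus>\<^bsub>R\<^esub>k\<in>{..<n}. M $$ (i, k) \<otimes>\<^bsub>R\<^esub> N $$ (k, j))),
      one = mat n n (\<lambda>(i, j). if i = j then \<one>\<^bsub>R\<^esub> else \<zero>\<^bsub>R\<^esub>),
      zero = mat n n (\<lambda>_. \<zero>\<^bsub>R\<^esub>),
      add = (\<lambda>M N. mat n n (\<lambda>(i, j). M $$ (i, j) \<oplus>\<^bsub>R\<^esub> N $$ (i, j)))\<rparr>"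

definition stably_finite :: "('a, 'm) ring_scheme \<Rightarrow> bool" where
  "stably_finite R \<longleftrightarrow> (\<forall>n. directly_finite (matrix_ring n R))"


section \<open>Polynomial identities\<close>

text \<open>
  An element of the free associative algebra on the variables \<open>X\<^sub>i\<close>, \<open>i < m\<close>, is a finitely supported
  coefficient function on the words in the alphabet \<open>{..<m}\<close>.
\<close>

definition free_algebra_polys :: "nat \<Rightarrow> (nat list \<Rightarrow>\<^sub>0 'f::zero) set" where
  "free_algebra_polys m = {f. Poly_Mapping.keys f \<subseteq> lists {..<m}}"

definition eval_word :: "('a, 'm) monoid_scheme \<Rightarrow> (nat \<Rightarrow> 'a) \<Rightarrow> nat list \<Rightarrow> 'a" where
  "eval_word A a w = foldr (\<lambda>i x. a i \<otimes>\<^bsub>A\<^esub> x) w \<one>\<^bsub>A\<^esub>"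

definition eval_poly ::
  "('f::zero, 'a, 'm) module_scheme \<Rightarrow> (nat list \<Rightarrow>\<^sub>0 'f) \<Rightarrow> (nat \<Rightarrow> 'a) \<Rightarrow> 'a" where
  "eval_poly A f a =
     (\<Oplus>\<^bsub>A\<^esub>w\<in>Poly_Mapping.keys f. Poly_Mapping.lookup f w \<odot>\<^bsub>A\<^esub> eval_word A a w)"

definition satisfies_polynomial_identity :: "('f::zero, 'a, 'm) module_scheme \<Rightarrow> bool" where
  "satisfies_polynomial_identity A \<longleftrightarrow>
     (\<exists>m\<ge>1. \<exists>f\<in>free_algebra_polys m. f \<noteq> 0 \<and>
        (\<forall>a \<in> {..<m} \<rightarrow> carrier A. eval_poly A f a = \<zero>\<^bsub>A\<^esub>))"

end

theory Submission
  imports "HOL-Analysis.Elementary_Topology" "Jordan_Normal_Form.Ring_Hom_Matrix" Defs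
begin

text \<open>
  The algebra is generated by elements \<open>x\<close>, \<open>u\<close>, \<open>v\<close> whose only surviving words are the
  powers \<open>x\<^sup>k\<close>, the words \<open>u x\<^sup>k\<close>, the words \<open>x\<^sup>k v\<close>, and \<open>u x\<^sup>k v\<close>. The last equals a fixed element
  \<open>m \<noteq> 0\<close> when \<open>k\<close> is a square and vanishes otherwise. It can be seen as an algebra of upper triangular
  3 by 3 matrices with polynomial entries, in which products arriving in the corner are evaluated by a
  linear functional; the matrix of the bilinear form \<open>(u x\<^sup>i, x\<^sup>j v)\<close> is the Hankel matrix of the set of
  squares.
  
  This Hankel matrix has infinite rank, and that excludes linear soficity. Squares have growing gaps,
  so for each \<open>d\<close> the elements \<open>u\<^sub>i = u x\<^sup>i\<close> and \<open>v\<^sub>j = x\<^sup>e v\<close> with \<open>e = d\<^sup>2 - j\<close> and \<open>i, j < d\<close> satisfy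
  \<open>u\<^sub>i v\<^sub>i = m\<close>, and \<open>u\<^sub>i v\<^sub>j = 0\<close> for \<open>j < i\<close>. If matrices of size \<open>n\<close> satisfied these relations, the
  column spaces of the \<open>v\<^sub>j\<close> would contribute \<open>d\<close> independent pieces of dimension at least that of the
  rank of \<open>m\<close>, so this rank would be at most \<open>n / d\<close>. The estimate tolerates errors of small rank
  (\<open>rank_matrix_units_bound\<close>). Thus in any metric ultraproduct the image of \<open>m\<close> has asymptotic rank at
  most \<open>1 / d\<close> for every \<open>d\<close>, which means that it is zero (\<open>not_linear_sofic_if_matrix_units\<close>).
  
  The diagonal is a homomorphism onto a commutative polynomial ring, and any product of three elements
  of its kernel vanishes. Commutators lie in the kernel, so the cube of a commutator is an identity.
  A one-sided inverse of a square matrix is two-sided over the polynomial ring, and the defect lifts to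
  an idempotent matrix with entries in the nilpotent kernel, which is zero
  (\<open>right_inverse_imp_left_inverse_mat_nilpotent_kernel\<close>); this gives stable finiteness.
\<close>

section \<open>A rank inequality for approximate matrix units\<close>

context vec_space
begin

abbreviation subsp where "subsp W \<equiv> subspace class_ring W V"
definition sdim where "sdim W = vectorspace.dim class_ring (vs W)"

lemma subsp_carrier: "subsp W \<Longrightarrow> W \<subseteq> carrier_vec n"
  unfolding subspace_def submodule_def by auto

lemma subspI:
  assumes "W \<subseteq> carrier_vec n" "0\<^sub>v n \<in> W"
    "\<And>x y. x \<in> W \<Longrightarrow> y \<in> W \<Longrightarrow> x + y \<in> W" "\<And>c x. x \<in> W \<Longrightarrow> c \<cdot>\<^sub>v x \<in> W"
  shows "subsp W"
  using assms vectorspace_axioms module_axioms unfolding subspace_def submodule_def by auto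

lemma subspD:
  assumes "subsp W"
  shows "0\<^sub>v n \<in> W" "\<And>x y. x \<in> W \<Longrightarrow> y \<in> W \<Longrightarrow> x + y \<in> W"
    "\<And>c x. x \<in> W \<Longrightarrow> c \<cdot>\<^sub>v x \<in> W"
  using assms unfolding subspace_def submodule_def by auto

text \<open>
  Independent sets in a subspace have at most \<open>n\<close> elements, so a maximal one exists; it generates.
\<close>

lemma fin_dim_subsp:
  assumes W: "subsp W"
  shows "vectorspace.fin_dim class_ring (vs W)"
proof -
  interpret W: vectorspace class_ring "vs W" by (rule subspace_is_vs[OF W])
  have sub: "submodule class_ring W V" using W by (simp add: subspace_def)
  have "\<exists>B. finite B \<and> maximal B (\<lambda>S. S \<subseteq> carrier (vs W) \<and> W.lin_indpt S)"
  proof (rule maximal_exists[where N = dim and B = "{}"])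
    fix S assume S: "S \<subseteq> carrier (vs W) \<and> W.lin_indpt S"
    then have "S \<subseteq> carrier_vec n" "lin_indpt S"
      using subsp_carrier[OF W] span_li_not_depend(2)[OF _ sub, of S] by auto
    then show "finite S \<and> card S \<le> dim" using li_le_dim[OF fin_dim] by simp
  next
    show "{} \<subseteq> carrier (vs W) \<and> W.lin_indpt {}" by (auto simp: W.lin_dep_def)
  qed
  then obtain B where B: "finite B" "maximal B (\<lambda>S. S \<subseteq> carrier (vs W) \<and> W.lin_indpt S)"
    by blast
  then have "W.gen_set B" by (intro W.max_li_is_gen)
  then show ?thesis using B unfolding W.fin_dim_def maximal_def by blast
qed

lemma sdim_mono:
  assumes "subsp W" "subsp W'" "W \<subseteq> W'"
  shows "sdim W \<le> sdim W'"
proof -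
  interpret W: vectorspace class_ring "vs W'" by (rule subspace_is_vs[OF assms(2)])
  have "subspace class_ring W (vs W')" by (rule nested_subspaces) fact+
  from W.subspace_dim[OF this fin_dim_subsp[OF assms(2)]] fin_dim_subsp[OF assms(1)]
  show ?thesis by (simp add: sdim_def)
qed

lemma rank_nullity_subsp:
  assumes A: "A \<in> carrier_mat n n" and W: "subsp W"
  shows "subsp ((*\<^sub>v) A ` W)" "subsp {x \<in> W. A *\<^sub>v x = 0\<^sub>v n}"
    "sdim W = sdim ((*\<^sub>v) A ` W) + sdim {x \<in> W. A *\<^sub>v x = 0\<^sub>v n}"
proof -
  note c = subsp_carrier[OF W]
  interpret W: vectorspace class_ring "vs W" by (rule subspace_is_vs[OF W])
  have "(*\<^sub>v) A \<in> LinearCombinations.module_hom class_ring (vs W) V"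
    unfolding LinearCombinations.module_hom_def using A c
    by (auto simp: mult_add_distrib_mat_vec[OF A] mult_mat_vec[OF A] subset_iff)
  then interpret T: linear_map class_ring "vs W" V "(*\<^sub>v) A"
    by unfold_locales
  show "subsp ((*\<^sub>v) A ` W)"
    using T.imT_is_subspace unfolding T.im_def by simp
  have k: "T.kerT = {x \<in> W. A *\<^sub>v x = 0\<^sub>v n}" unfolding T.ker_def by simp
  show "subsp {x \<in> W. A *\<^sub>v x = 0\<^sub>v n}"
    using c subspD[OF W] A
    by (intro subspI)
      (auto simp: mult_add_distrib_mat_vec[OF A] mult_mat_vec[OF A] subset_iff)
  show "sdim W = sdim ((*\<^sub>v) A ` W) + sdim {x \<in> W. A *\<^sub>v x = 0\<^sub>v n}"
    using T.rank_nullity[OF fin_dim_subsp[OF W]] unfolding k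
    by (simp add: T.im_def sdim_def)
qed

lemma subsp_carrier_vec: "subsp (carrier_vec n)"
  by (intro subspI) auto

lemma rank_eq_sdim:
  assumes A: "A \<in> carrier_mat n n"
  shows "rank A = sdim ((*\<^sub>v) A ` carrier_vec n)"
proof -
  have "(*\<^sub>v) A ` carrier_vec n = span (set (cols A))"
    using col_space_eq[OF A] A unfolding col_space_def by auto
  then show ?thesis by (simp add: sdim_def rank_def)
qed

lemma rank_smult_le:
  assumes A: "A \<in> carrier_mat n n"
  shows "rank (c \<cdot>\<^sub>m A) \<le> rank A"
proof -
  have cA: "c \<cdot>\<^sub>m A \<in> carrier_mat n n" using A by simp
  have "(*\<^sub>v) (c \<cdot>\<^sub>m A) ` carrier_vec n \<subseteq> (*\<^sub>v) A ` carrier_vec n"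
  proof
    fix y assume "y \<in> (*\<^sub>v) (c \<cdot>\<^sub>m A) ` carrier_vec n"
    then obtain x where x: "x \<in> carrier_vec n" "y = (c \<cdot>\<^sub>m A) *\<^sub>v x" by blast
    have "y = A *\<^sub>v (c \<cdot>\<^sub>v x)"
      using x A by (auto simp: mult_mat_vec[OF A])
    then show "y \<in> (*\<^sub>v) A ` carrier_vec n" using x(1) by auto
  qed
  then show ?thesis
    unfolding rank_eq_sdim[OF A] rank_eq_sdim[OF cA]
    by (intro sdim_mono rank_nullity_subsp[OF _ subsp_carrier_vec] A cA)
qed

lemma rank_le_add_diff:
  assumes A: "A \<in> carrier_mat n n" and B: "B \<in> carrier_mat n n"
  shows "rank A \<le> rank B + rank (B - A)"
proof -
  have "A = B + (- 1) \<cdot>\<^sub>m (B - A)" using A B by (intro eq_matI) auto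
  then have "rank A \<le> rank B + rank ((- 1) \<cdot>\<^sub>m (B - A))"
    by (metis A B minus_carrier_mat rank_subadditive smult_carrier_mat)
  also have "\<dots> \<le> rank B + rank (B - A)" using rank_smult_le[OF minus_carrier_mat[OF A]] by simp
  finally show ?thesis .
qed

lemma sdim_sum_le:
  assumes "subsp W" "subsp W'"
  shows "sdim (subspace_sum W W') \<le> sdim W + sdim W'"
  unfolding sdim_def using assms by (intro dim_subadditive fin_dim_subsp)

lemma mult_image_sum:
  assumes A: "A \<in> carrier_mat n n" and W: "subsp W" and W': "subsp W'"
  shows "(*\<^sub>v) A ` subspace_sum W W' = subspace_sum ((*\<^sub>v) A ` W) ((*\<^sub>v) A ` W')"
proof -
  have *: "A *\<^sub>v (x + y) = A *\<^sub>v x + A *\<^sub>v y" if "x \<in> W" "y \<in> W'" for x y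
    using that subsp_carrier[OF W] subsp_carrier[OF W']
    by (intro mult_add_distrib_mat_vec[OF A]) auto
  show ?thesis unfolding submodule_sum_def by (force simp: image_iff *)
qed

text \<open>
  The nullity of \<open>A\<close> on a subspace, which by rank-nullity is the drop in dimension under \<open>A\<close>,
  can only grow with the subspace.
\<close>

lemma sdim_step:
  assumes A: "A \<in> carrier_mat n n" and W: "subsp W" and W': "subsp W'" and le: "W \<subseteq> W'"
  shows "sdim W + sdim ((*\<^sub>v) A ` W') \<le> sdim W' + sdim ((*\<^sub>v) A ` W)"
proof -
  have "sdim {x \<in> W. A *\<^sub>v x = 0\<^sub>v n} \<le> sdim {x \<in> W'. A *\<^sub>v x = 0\<^sub>v n}"
    using le by (intro sdim_mono rank_nullity_subsp A W W') auto
  then show ?thesis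
    using rank_nullity_subsp(3)[OF A W] rank_nullity_subsp(3)[OF A W'] by linarith
qed

text \<open>
  If \<open>P i * Q j\<close> were exactly \<open>M\<close> for \<open>i = j\<close> and \<open>0\<close> for \<open>j < i\<close>, the column spaces of the
  \<open>Q j\<close> would each contribute \<open>rank M\<close> new dimensions to their sum: \<open>P i\<close> kills the earlier ones and
  maps the \<open>i\<close>-th onto the column space of \<open>M\<close>. All of this takes place in dimension \<open>n\<close>, so
  \<open>k * rank M \<le> n\<close>. In general the deviations from these products enter through their ranks.
\<close>

lemma rank_matrix_units_bound:
  fixes P Q :: "nat \<Rightarrow> 'a mat"
  assumes P: "\<And>i. i < k \<Longrightarrow> P i \<in> carrier_mat n n"
    and Q: "\<And>i. i < k \<Longrightarrow> Q i \<in> carrier_mat n n"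
    and M: "M \<in> carrier_mat n n"
  shows "k * rank M \<le> n + (\<Sum>i<k. rank (P i * Q i - M) + (\<Sum>j<i. rank (P i * Q j)))"
proof -
  \<comment> \<open>\<open>X\<close> is the sum of the column spaces of the \<open>Q j\<close> with \<open>j < i\<close>.\<close>
  have "\<exists>X. subsp X
      \<and> (\<forall>A\<in>carrier_mat n n. sdim ((*\<^sub>v) A ` X) \<le> (\<Sum>j<i. rank (A * Q j)))
      \<and> i * rank M \<le> sdim X + (\<Sum>l<i. rank (P l * Q l - M) + (\<Sum>j<l. rank (P l * Q j)))"
    if "i \<le> k" for i
    using that
  proof (induction i)
    case 0
    have s: "subsp {0\<^sub>v n}" by (intro subspI) auto
    have "sdim ((*\<^sub>v) A ` {0\<^sub>v n}) = 0" if A: "A \<in> carrier_mat n n" for A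
    proof -
      have "A *\<^sub>v 0\<^sub>v n = 0\<^sub>v n" using A by (intro eq_vecI) auto
      moreover have "0\<^sub>m n n *\<^sub>v x = 0\<^sub>v n" if "x \<in> carrier_vec n" for x :: "'a vec"
        using that by (intro eq_vecI) auto
      ultimately have "(*\<^sub>v) A ` {0\<^sub>v n} = (*\<^sub>v) (0\<^sub>m n n) ` carrier_vec n"
        by (auto simp: image_iff intro!: bexI[of _ "0\<^sub>v n"])
      then show ?thesis by (metis rank_eq_sdim rank_0I zero_carrier_mat)
    qed
    then show ?case using s by (intro exI[of _ "{0\<^sub>v n}"]) simp
  next
    case (Suc i)
    from Suc.IH[OF Suc_leD[OF Suc.prems]] obtain X where X: "subsp X"
      and img: "\<And>A. A \<in> carrier_mat n n \<Longrightarrow> sdim ((*\<^sub>v) A ` X) \<le> (\<Sum>j<i. rank (A * Q j))"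
      and low: "i * rank M
        \<le> sdim X + (\<Sum>l<i. rank (P l * Q l - M) + (\<Sum>j<l. rank (P l * Q j)))"
      by blast
    have Pi: "P i \<in> carrier_mat n n" and Qi: "Q i \<in> carrier_mat n n" using P Q Suc.prems by auto
    let ?R = "(*\<^sub>v) (Q i) ` carrier_vec n"
    let ?X = "subspace_sum X ?R"
    have R: "subsp ?R" by (intro rank_nullity_subsp Qi subsp_carrier_vec)
    have X': "subsp ?X" by (intro sum_is_subspace X R)
    have imR: "(*\<^sub>v) A ` ?R = (*\<^sub>v) (A * Q i) ` carrier_vec n" if "A \<in> carrier_mat n n" for A
      using that Qi by (auto simp: image_image intro!: image_cong)
    have rkR: "sdim ((*\<^sub>v) A ` ?R) = rank (A * Q i)" if "A \<in> carrier_mat n n" for A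
      using imR[OF that] rank_eq_sdim[of "A * Q i"] that Qi by simp
    have 1: "sdim ((*\<^sub>v) A ` ?X) \<le> (\<Sum>j<Suc i. rank (A * Q j))"
      if A: "A \<in> carrier_mat n n" for A
    proof -
      have "sdim ((*\<^sub>v) A ` ?X) \<le> sdim ((*\<^sub>v) A ` X) + sdim ((*\<^sub>v) A ` ?R)"
        unfolding mult_image_sum[OF A X R]
        by (intro sdim_sum_le rank_nullity_subsp A X R)
      then show ?thesis using img[OF A] rkR[OF A] by simp
    qed
    have XX: "X \<subseteq> ?X" "?R \<subseteq> ?X"
      using in_sum_vs[OF X R] in_sum_vs[OF R X] vsum_comm[OF X R] by simp_all
    have "rank M \<le> rank (P i * Q i) + rank (P i * Q i - M)"
      by (rule rank_le_add_diff) (use Pi Qi M in auto)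
    also have "rank (P i * Q i) \<le> sdim ((*\<^sub>v) (P i) ` ?X)"
      unfolding rkR[OF Pi, symmetric]
      by (intro sdim_mono rank_nullity_subsp Pi R X' image_mono XX)
    finally have "rank M \<le> sdim ((*\<^sub>v) (P i) ` ?X) + rank (P i * Q i - M)" by simp
    with sdim_step[OF Pi X X' XX(1)] img[OF Pi] low
    have "Suc i * rank M
        \<le> sdim ?X + (\<Sum>l<Suc i. rank (P l * Q l - M) + (\<Sum>j<l. rank (P l * Q j)))"
      by simp
    with 1 X' show ?case by blast
  qed
  from this[of k] obtain X where X: "subsp X" and *: "k * rank M
      \<le> sdim X + (\<Sum>i<k. rank (P i * Q i - M) + (\<Sum>j<i. rank (P i * Q j)))" by blast
  have "sdim X \<le> sdim (carrier_vec n)"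
    using X by (intro sdim_mono subsp_carrier_vec subsp_carrier)
  also have "\<dots> = n"
    using rank_eq_sdim[OF one_carrier_mat] det_rank_iff[OF one_carrier_mat] by simp
  finally show ?thesis using * by simp
qed

end

section \<open>An obstruction to linear soficity\<close>

text \<open>
  By compactness the values of \<open>f\<close> cluster at some point along the filter. For an ultrafilter a
  cluster point is a limit, since \<open>f\<close> eventually stays in each neighbourhood or in its complement.
\<close>

lemma tendsto_Lim_ultrafilter:
  fixes f :: "'i \<Rightarrow> 'b::{t2_space}"
  assumes U: "nonprincipal_ultrafilter U" and K: "compact K" "\<And>k. f k \<in> K"
  shows "(f \<longlongrightarrow> Lim U f) U"
proof -
  have nb: "U \<noteq> bot" and ultra: "eventually P U \<or> eventually (\<lambda>k. \<not> P k) U" for P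
    using U by (auto simp: nonprincipal_ultrafilter_def)
  have "filtermap f U \<noteq> bot" "eventually (\<lambda>x. x \<in> K) (filtermap f U)"
    using nb K(2) by (auto simp: filtermap_bot_iff eventually_filtermap)
  then obtain x where x: "inf (nhds x) (filtermap f U) \<noteq> bot"
    using K(1) by (auto simp: compact_filter)
  have "(f \<longlongrightarrow> x) U"
  proof (rule topological_tendstoI)
    fix S assume S: "open S" "x \<in> S"
    show "eventually (\<lambda>k. f k \<in> S) U"
    proof (rule ccontr)
      assume "\<not> eventually (\<lambda>k. f k \<in> S) U"
      then have "eventually (\<lambda>y. y \<notin> S) (filtermap f U)"
        using ultra[of "\<lambda>k. f k \<in> S"] by (simp add: eventually_filtermap)
      moreover have "eventually (\<lambda>y. y \<in> S) (nhds x)"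
        using S by (simp add: eventually_nhds_in_open)
      ultimately have "eventually (\<lambda>_. False) (inf (nhds x) (filtermap f U))"
        unfolding eventually_inf by blast
      with x show False by (simp add: trivial_limit_def)
    qed
  qed
  then show ?thesis using nb tendsto_Lim by metis
qed

lemma asymptotic_rank_eq_0_iff:
  fixes P :: "nat \<Rightarrow> 'f::field mat"
  assumes U: "nonprincipal_ultrafilter U" and P: "\<And>k. P k \<in> carrier_mat (n k) (n k)"
  shows "asymptotic_rank U n P = 0
    \<longleftrightarrow> ((\<lambda>k. real (vec_space.rank (n k) (P k)) / real (n k)) \<longlongrightarrow> 0) U"
proof -
  let ?r = "\<lambda>k. real (vec_space.rank (n k) (P k)) / real (n k)"
  have "?r k \<in> {0..1}" for k
    using vec_space.rank_le_nc[OF P[of k]] by (auto simp: divide_le_eq_1)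
  then have "(?r \<longlongrightarrow> Lim U ?r) U"
    by (intro tendsto_Lim_ultrafilter[OF U compact_Icc])
  then show ?thesis using U tendsto_Lim[of U ?r 0]
    by (auto simp: asymptotic_rank_def nonprincipal_ultrafilter_def)
qed

definition normalised_rank :: "(nat \<Rightarrow> nat) \<Rightarrow> (nat \<Rightarrow> 'f::field mat) \<Rightarrow> nat \<Rightarrow> real" where
  "normalised_rank n P k = real (vec_space.rank (n k) (P k)) / real (n k)"

lemma mem_asymptotic_rank_kernel_iff:
  fixes P :: "nat \<Rightarrow> 'f::field mat"
  assumes U: "nonprincipal_ultrafilter U"
  shows "P \<in> asymptotic_rank_kernel U n \<longleftrightarrow>
    P \<in> carrier (matrix_product n) \<and> (normalised_rank n P \<longlongrightarrow> 0) U"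
  using asymptotic_rank_eq_0_iff[OF U, of P n]
  by (auto simp: asymptotic_rank_kernel_def matrix_product_def normalised_rank_def[abs_def])

lemma tendsto_0_le:
  fixes f g :: "'i \<Rightarrow> real"
  assumes "\<And>k. 0 \<le> f k" "\<And>k. f k \<le> g k" "(g \<longlongrightarrow> 0) U"
  shows "(f \<longlongrightarrow> 0) U"
  using assms by (intro tendsto_sandwich[of "\<lambda>_. 0" f U g 0]) auto

lemma asymptotic_rank_kernel_closed:
  fixes P Q :: "nat \<Rightarrow> 'f::field mat"
  assumes U: "nonprincipal_ultrafilter U"
  shows "(\<lambda>k. 0\<^sub>m (n k) (n k)) \<in> (asymptotic_rank_kernel U n :: (nat \<Rightarrow> 'f mat) set)"
    and "P \<in> asymptotic_rank_kernel U n \<Longrightarrow> Q \<in> asymptotic_rank_kernel U n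
      \<Longrightarrow> (\<lambda>k. P k + Q k) \<in> asymptotic_rank_kernel U n"
    and "P \<in> asymptotic_rank_kernel U n \<Longrightarrow> (\<lambda>k. c \<cdot>\<^sub>m P k) \<in> asymptotic_rank_kernel U n"
proof -
  note mem = mem_asymptotic_rank_kernel_iff[OF U]
  show "(\<lambda>k. 0\<^sub>m (n k) (n k)) \<in> (asymptotic_rank_kernel U n :: (nat \<Rightarrow> 'f mat) set)"
    by (simp add: mem matrix_product_def normalised_rank_def[abs_def] vec_space.rank_0I)
next
  note mem = mem_asymptotic_rank_kernel_iff[OF U]
  assume P: "P \<in> asymptotic_rank_kernel U n" and Q: "Q \<in> asymptotic_rank_kernel U n"
  then have c: "P k \<in> carrier_mat (n k) (n k)" "Q k \<in> carrier_mat (n k) (n k)" for k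
    by (auto simp: mem matrix_product_def)
  have "normalised_rank n (\<lambda>k. P k + Q k) k \<le> normalised_rank n P k + normalised_rank n Q k" for k
    using vec_space.rank_subadditive[OF c[of k]]
    by (simp add: normalised_rank_def add_divide_distrib[symmetric] divide_right_mono)
  moreover have "((\<lambda>k. normalised_rank n P k + normalised_rank n Q k) \<longlongrightarrow> 0) U"
    using P Q by (auto simp: mem intro!: tendsto_add_zero)
  ultimately have "(normalised_rank n (\<lambda>k. P k + Q k) \<longlongrightarrow> 0) U"
    by (rule tendsto_0_le[rotated]) (simp add: normalised_rank_def)
  with c show "(\<lambda>k. P k + Q k) \<in> asymptotic_rank_kernel U n"
    by (simp add: mem matrix_product_def)
next
  note mem = mem_asymptotic_rank_kernel_iff[OF U]
  assume P: "P \<in> asymptotic_rank_kernel U n"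
  then have c: "P k \<in> carrier_mat (n k) (n k)" for k
    by (auto simp: mem matrix_product_def)
  have "normalised_rank n (\<lambda>k. c \<cdot>\<^sub>m P k) k \<le> normalised_rank n P k" for k
    using vec_space.rank_smult_le[OF c[of k]]
    by (simp add: normalised_rank_def divide_right_mono)
  with P have "(normalised_rank n (\<lambda>k. c \<cdot>\<^sub>m P k) \<longlongrightarrow> 0) U"
    by (intro tendsto_0_le[where g = "normalised_rank n P" and f = "normalised_rank n (\<lambda>k. c \<cdot>\<^sub>m P k)"])
      (simp_all add: normalised_rank_def mem)
  with c show "(\<lambda>k. c \<cdot>\<^sub>m P k) \<in> asymptotic_rank_kernel U n"
    by (simp add: mem matrix_product_def)
qed

text \<open>
  Dividing the bound of \<open>rank_matrix_units_bound\<close> by \<open>d * n k\<close> and passing to the limit shows that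
  the asymptotic rank of \<open>M\<close> is at most \<open>1 / d\<close>, for every \<open>d\<close>.
\<close>

lemma approximate_matrix_units_in_kernel:
  fixes M :: "nat \<Rightarrow> 'f::field mat"
  assumes U: "nonprincipal_ultrafilter U" and n: "\<And>k. 0 < n k"
    and M: "M \<in> carrier (matrix_product n)"
    and units: "\<And>d::nat. \<exists>P Q. (\<forall>i<d. P i \<in> carrier (matrix_product n) \<and> Q i \<in> carrier (matrix_product n)
        \<and> (\<lambda>k. P i k * Q i k - M k) \<in> asymptotic_rank_kernel U n
        \<and> (\<forall>j<i. (\<lambda>k. P i k * Q j k) \<in> asymptotic_rank_kernel U n))"
  shows "M \<in> asymptotic_rank_kernel U n"
proof -
  note mem = mem_asymptotic_rank_kernel_iff[OF U]
  have "(normalised_rank n M \<longlongrightarrow> 0) U"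
  proof (rule tendstoI)
    fix e :: real assume e: "0 < e"
    \<comment> \<open>Eventually the errors sum to less than 1, so the normalised rank of \<open>M\<close> is below \<open>2 / d\<close>.\<close>
    obtain d where d: "2 / e < real d" using reals_Archimedean2 by blast
    then have d0: "0 < real d" using e by (meson divide_pos_pos less_trans zero_less_numeral)
    from units[of d] obtain P Q where "\<forall>i<d. P i \<in> carrier (matrix_product n) \<and> Q i \<in> carrier (matrix_product n)
        \<and> (\<lambda>k. P i k * Q i k - M k) \<in> asymptotic_rank_kernel U n
        \<and> (\<forall>j<i. (\<lambda>k. P i k * Q j k) \<in> asymptotic_rank_kernel U n)" by (elim exE)
    then have PQ: "\<And>i. i < d \<Longrightarrow> P i \<in> carrier (matrix_product n)"
        "\<And>i. i < d \<Longrightarrow> Q i \<in> carrier (matrix_product n)"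
        "\<And>i. i < d \<Longrightarrow> (\<lambda>k. P i k * Q i k - M k) \<in> asymptotic_rank_kernel U n"
        "\<And>i j. i < d \<Longrightarrow> j < i \<Longrightarrow> (\<lambda>k. P i k * Q j k) \<in> asymptotic_rank_kernel U n"
      by simp_all
    define err where "err k = (\<Sum>i<d. normalised_rank n (\<lambda>k. P i k * Q i k - M k) k
        + (\<Sum>j<i. normalised_rank n (\<lambda>k. P i k * Q j k) k))" for k
    have "(err \<longlongrightarrow> (\<Sum>i<d. 0 + (\<Sum>j<i. 0))) U"
      unfolding err_def using PQ(3,4) by (intro tendsto_intros) (auto simp: mem)
    then have "eventually (\<lambda>k. err k < 1) U" by (intro order_tendstoD(2)) auto
    moreover have "dist (normalised_rank n M k) 0 < e" if "err k < 1" for k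
    proof -
      let ?S = "\<Sum>i<d. vec_space.rank (n k) (P i k * Q i k - M k)
          + (\<Sum>j<i. vec_space.rank (n k) (P i k * Q j k))"
      have "d * vec_space.rank (n k) (M k) \<le> n k + ?S"
        using PQ(1,2) M
        by (intro vec_space.rank_matrix_units_bound) (auto simp: matrix_product_def)
      then have "real (d * vec_space.rank (n k) (M k)) / real (n k) \<le> real (n k + ?S) / real (n k)"
        by (intro divide_right_mono of_nat_mono) simp_all
      also have "real (d * vec_space.rank (n k) (M k)) / real (n k) = real d * normalised_rank n M k"
        by (simp add: normalised_rank_def)
      also have "real (n k + ?S) / real (n k) = 1 + real ?S / real (n k)"
        using n[of k] by (simp only: of_nat_add add_divide_distrib) simp
      also have "real ?S / real (n k) = err k"
        by (simp add: err_def normalised_rank_def add_divide_distrib sum_divide_distrib)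
      finally have "real d * normalised_rank n M k < 2" using that by simp
      also have "2 < real d * e" using d e by (simp add: divide_less_eq)
      finally have "normalised_rank n M k < e" using d0 by simp
      then show ?thesis by (simp add: normalised_rank_def)
    qed
    ultimately show "eventually (\<lambda>k. dist (normalised_rank n M k) 0 < e) U"
      by (rule eventually_mono)
  qed
  with M show ?thesis by (simp add: mem)
qed

text \<open>
  A homomorphism to a metric ultraproduct turns the relations into relations between representing
  sequences of matrices that hold up to asymptotic rank zero, so it sends \<open>m\<close> to zero. The families
  may depend on their length \<open>d\<close>, since each \<open>d\<close> gives a separate bound for the rank of \<open>m\<close>.
\<close>

theorem not_linear_sofic_if_matrix_units:
  fixes A :: "('f::field, 'a, 'm) module_scheme" and u v :: "nat \<Rightarrow> nat \<Rightarrow> 'a"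
  assumes A: "assoc_algebra A"
    and m: "m \<in> carrier A" "m \<noteq> \<zero>\<^bsub>A\<^esub>"
    and u: "\<And>d i. i < d \<Longrightarrow> u d i \<in> carrier A"
    and v: "\<And>d i. i < d \<Longrightarrow> v d i \<in> carrier A"
    and uv: "\<And>d i. i < d \<Longrightarrow> u d i \<otimes>\<^bsub>A\<^esub> v d i = m"
      "\<And>d i j. i < d \<Longrightarrow> j < i \<Longrightarrow> u d i \<otimes>\<^bsub>A\<^esub> v d j = \<zero>\<^bsub>A\<^esub>"
  shows "\<not> linear_sofic A"
proof
  interpret assoc_algebra A by (rule A)
  assume "linear_sofic A"
  then obtain U n \<Phi> where U: "nonprincipal_ultrafilter U" and n: "\<And>k. 0 < n k"
    and \<Phi>: "\<Phi> \<in> algebra_hom A (metric_ultraproduct U n)" and inj: "inj_on \<Phi> (carrier A)"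
    unfolding linear_sofic_def by blast
  let ?R = "matrix_product n :: ('f, nat \<Rightarrow> 'f mat) module"
  let ?K = "asymptotic_rank_kernel U n :: (nat \<Rightarrow> 'f mat) set"
  note K = asymptotic_rank_kernel_closed[OF U, where n = n]
  have K_carrier: "?K \<subseteq> carrier ?R" by (auto simp: asymptotic_rank_kernel_def)
  have coset: "?K +>\<^bsub>?R\<^esub> P = {(\<lambda>k. Z k + P k) | Z. Z \<in> ?K}" for P
    by (auto simp: a_r_coset_def' matrix_product_def)
  have self: "P \<in> ?K +>\<^bsub>?R\<^esub> P" if "P \<in> carrier ?R" for P
  proof -
    have "P = (\<lambda>k. 0\<^sub>m (n k) (n k) + P k)" using that by (auto simp: matrix_product_def)
    then show ?thesis using K(1) by (auto simp: coset)
  qed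
  have rep: "\<exists>P \<in> carrier ?R. \<Phi> x = ?K +>\<^bsub>?R\<^esub> P" if "x \<in> carrier A" for x
    using that \<Phi>
    by (auto simp: algebra_hom_def LinearCombinations.module_hom_def metric_ultraproduct_def
        quotient_algebra_def FactRing_def A_RCOSETS_def' Pi_iff)
  have mult: "(\<lambda>k. P k * Q k) \<in> \<Phi> (x \<otimes>\<^bsub>A\<^esub> y)"
    if "x \<in> carrier A" "y \<in> carrier A" "P \<in> \<Phi> x" "Q \<in> \<Phi> y" "P \<in> carrier ?R" "Q \<in> carrier ?R" for x y P Q
  proof -
    have "\<Phi> (x \<otimes>\<^bsub>A\<^esub> y) = rcoset_mult ?R ?K (\<Phi> x) (\<Phi> y)"
      using \<Phi> that by (simp add: algebra_hom_def metric_ultraproduct_def quotient_algebra_def FactRing_def)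
    moreover have "(\<lambda>k. P k * Q k) \<in> ?K +>\<^bsub>?R\<^esub> (\<lambda>k. P k * Q k)"
      using that(5,6) by (intro self) (auto simp: matrix_product_def intro: mult_carrier_mat)
    ultimately show ?thesis
      using that(3,4) by (auto simp: rcoset_mult_def) (auto simp: matrix_product_def)
  qed
  obtain M where M: "M \<in> carrier ?R" "\<Phi> m = ?K +>\<^bsub>?R\<^esub> M" using rep[OF m(1)] by blast
  \<comment> \<open>The zero of \<open>A\<close> is \<open>0 \<odot> m\<close>, and scaling by 0 turns every coset into the kernel.\<close>
  have \<Phi>0: "\<Phi> \<zero>\<^bsub>A\<^esub> = ?K"
  proof -
    have "\<Phi> (0 \<odot>\<^bsub>A\<^esub> m) = 0 \<odot>\<^bsub>metric_ultraproduct U n\<^esub> \<Phi> m"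
      using \<Phi> m(1) by (simp add: algebra_hom_def LinearCombinations.module_hom_def)
    also have "\<dots> = (\<Union>P\<in>\<Phi> m. ?K +>\<^bsub>?R\<^esub> (\<lambda>k. 0 \<cdot>\<^sub>m P k))"
      by (simp add: metric_ultraproduct_def quotient_algebra_def matrix_product_def)
    also have "\<dots> = (\<Union>P\<in>\<Phi> m. ?K)"
    proof (intro SUP_cong refl)
      fix P assume "P \<in> \<Phi> m"
      then have P: "P k \<in> carrier_mat (n k) (n k)" for k
        using M(1) K_carrier unfolding M(2) coset by (auto simp: matrix_product_def)
      have "(\<lambda>k. Z k + 0 \<cdot>\<^sub>m P k) = Z" if "Z \<in> ?K" for Z
      proof
        fix k
        have "Z k \<in> carrier_mat (n k) (n k)" using that K_carrier by (auto simp: matrix_product_def)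
        then show "Z k + 0 \<cdot>\<^sub>m P k = Z k" using P[of k] by (intro eq_matI) auto
      qed
      then show "?K +>\<^bsub>?R\<^esub> (\<lambda>k. 0 \<cdot>\<^sub>m P k) = ?K" by (simp add: coset setcompr_eq_image cong: image_cong)
    qed
    also have "\<dots> = ?K" using self[OF M(1)] M(2) by auto
    moreover have "0 \<odot>\<^bsub>A\<^esub> m = \<zero>\<^bsub>A\<^esub>" using lmult_0[OF m(1)] by simp
    ultimately show ?thesis by simp
  qed
  have "M \<in> ?K"
  proof (rule approximate_matrix_units_in_kernel[OF U n M(1)])
    fix d
    have ex: "\<exists>P. P \<in> carrier ?R \<and> P \<in> \<Phi> x" if "x \<in> carrier A" for x
      using rep[OF that] self by metis
    define P where "P i = (SOME P. P \<in> carrier ?R \<and> P \<in> \<Phi> (u d i))" for i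
    define Q where "Q i = (SOME Q. Q \<in> carrier ?R \<and> Q \<in> \<Phi> (v d i))" for i
    have P: "P i \<in> carrier ?R" "P i \<in> \<Phi> (u d i)" if "i < d" for i
      using someI_ex[OF ex[OF u[OF that]]] by (simp_all add: P_def)
    have Q: "Q i \<in> carrier ?R" "Q i \<in> \<Phi> (v d i)" if "i < d" for i
      using someI_ex[OF ex[OF v[OF that]]] by (simp_all add: Q_def)
    have "(\<lambda>k. P i k * Q i k - M k) \<in> ?K" if i: "i < d" for i
    proof -
      have "(\<lambda>k. P i k * Q i k) \<in> \<Phi> m"
        using mult[OF u v P(2) Q(2) P(1) Q(1), OF i i i i i i] uv(1)[OF i] by simp
      then obtain Z where Z: "Z \<in> ?K" "(\<lambda>k. P i k * Q i k) = (\<lambda>k. Z k + M k)"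
        unfolding M(2) coset by blast
      have "P i k * Q i k - M k = Z k" for k
      proof -
        have "Z k \<in> carrier_mat (n k) (n k)" "M k \<in> carrier_mat (n k) (n k)"
          using Z(1) M(1) K_carrier by (auto simp: matrix_product_def)
        then show ?thesis using fun_cong[OF Z(2), of k] by (auto intro!: eq_matI)
      qed
      then show ?thesis using Z(1) by simp
    qed
    moreover have "(\<lambda>k. P i k * Q j k) \<in> ?K" if "i < d" "j < i" for i j
      using mult[OF u[OF that(1)] v P(2)[OF that(1)] Q(2) P(1)[OF that(1)] Q(1), of j]
        uv(2)[OF that] \<Phi>0 that by simp
    ultimately show "\<exists>P Q. \<forall>i<d. P i \<in> carrier ?R \<and> Q i \<in> carrier ?R
        \<and> (\<lambda>k. P i k * Q i k - M k) \<in> ?K \<and> (\<forall>j<i. (\<lambda>k. P i k * Q j k) \<in> ?K)"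
      using P(1) Q(1) by blast
  qed
  have "\<Phi> m = ?K"
  proof (intro equalityI subsetI)
    fix P assume "P \<in> \<Phi> m"
    then show "P \<in> ?K" unfolding M(2) coset using K(2) \<open>M \<in> ?K\<close> by auto
  next
    fix P assume P: "P \<in> ?K"
    let ?Z = "\<lambda>k. P k + (- 1) \<cdot>\<^sub>m M k"
    have "?Z \<in> ?K" using K(2)[OF P K(3)[OF \<open>M \<in> ?K\<close>]] .
    moreover have "P = (\<lambda>k. ?Z k + M k)"
    proof
      fix k
      have "P k \<in> carrier_mat (n k) (n k)" "M k \<in> carrier_mat (n k) (n k)"
        using P M(1) K_carrier by (auto simp: matrix_product_def)
      then show "P k = ?Z k + M k" by (intro eq_matI) auto
    qed
    ultimately show "P \<in> \<Phi> m"
      unfolding M(2) coset by (intro CollectI exI[of _ ?Z] conjI)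
  qed
  then have "m = \<zero>\<^bsub>A\<^esub>" using inj_onD[OF inj] \<Phi>0 m(1) by simp
  with m(2) show False by simp
qed

section \<open>One-sided inverses of matrices\<close>

text \<open>
  The determinant of \<open>A\<close> is a unit, so \<open>B\<close> is the adjugate of \<open>A\<close> divided by it.
\<close>

lemma right_inverse_imp_left_inverse_mat:
  fixes A B :: "'a::comm_ring_1 mat"
  assumes A: "A \<in> carrier_mat n n" and B: "B \<in> carrier_mat n n" and AB: "A * B = 1\<^sub>m n"
  shows "B * A = 1\<^sub>m n"
proof -
  have det: "det B * det A = 1"
    using det_mult[OF A B] by (simp add: AB mult.commute)
  note adj = adj_mat[OF A]
  have "det A \<cdot>\<^sub>m B = (det A \<cdot>\<^sub>m 1\<^sub>m n) * B"
    using B by (simp add: mult_smult_assoc_mat[OF one_carrier_mat])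
  also have "\<dots> = adj_mat A * (A * B)"
    using adj A B by (simp add: assoc_mult_mat[symmetric, of _ n n _ n _ n])
  also have "\<dots> = adj_mat A" using adj(1) by (simp add: AB)
  finally have adjA: "adj_mat A = det A \<cdot>\<^sub>m B" by simp
  have smult: "det B \<cdot>\<^sub>m (det A \<cdot>\<^sub>m C) = C" for C :: "'a mat"
    by (intro eq_matI) (simp_all add: mult.assoc[symmetric] det)
  have "B * A = det B \<cdot>\<^sub>m (det A \<cdot>\<^sub>m B) * A"
    by (simp only: smult)
  also have "\<dots> = det B \<cdot>\<^sub>m (adj_mat A * A)"
    by (simp only: adjA[symmetric] mult_smult_assoc_mat[OF adj(1) A])
  also have "\<dots> = 1\<^sub>m n" by (simp only: adj(3) smult)
  finally show ?thesis .
qed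

text \<open>
  Over the commutative quotient \<open>B * A\<close> becomes \<open>1\<close>, so \<open>1 - B * A\<close> has its entries in the kernel.
  It is also idempotent, hence equal to its cube, and the cube is zero.
\<close>

lemma right_inverse_imp_left_inverse_mat_nilpotent_kernel:
  fixes h :: "'a::ring_1 \<Rightarrow> 'b::comm_ring_1" and A B :: "'a mat"
  assumes h: "Ring_Hom.ring_hom h"
    and ker: "\<And>x y z. h x = 0 \<Longrightarrow> h y = 0 \<Longrightarrow> h z = 0 \<Longrightarrow> x * y * z = 0"
    and A: "A \<in> carrier_mat n n" and B: "B \<in> carrier_mat n n" and AB: "A * B = 1\<^sub>m n"
  shows "B * A = 1\<^sub>m n"
proof -
  interpret h: Ring_Hom.ring_hom h by (rule h)
  let ?h = "map_mat h"
  have "?h A * ?h B = 1\<^sub>m n"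
    using h.mat_hom_mult[OF A B] by (simp add: AB h.mat_hom_one)
  then have hBA: "?h (B * A) = 1\<^sub>m n"
    using right_inverse_imp_left_inverse_mat[of "?h A" n "?h B"] A B
    by (simp add: h.mat_hom_mult[OF B A])
  define E where "E = 1\<^sub>m n - B * A"
  have E: "E \<in> carrier_mat n n"
    unfolding E_def using mult_carrier_mat[OF B A] by (rule minus_carrier_mat)
  have hE: "h (E $$ (i, j)) = 0" if "i < n" "j < n" for i j
  proof -
    have "h ((B * A) $$ (i, j)) = 1\<^sub>m n $$ (i, j)"
      using arg_cong[OF hBA, of "\<lambda>M. M $$ (i, j)"] that A B by simp
    then show ?thesis using that A B by (auto simp: E_def h.hom_minus)
  qed
  have BA: "B * A \<in> carrier_mat n n" using A B by simp
  have "(B * A) * (B * A) = B * (A * B) * A"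
    using A B by (simp add: assoc_mult_mat[of _ n n _ n _ n])
  then have idem: "(B * A) * (B * A) = B * A" using A B by (simp add: AB)
  have "B * A * E = B * A - B * A"
    unfolding E_def mult_minus_distrib_mat[OF BA one_carrier_mat BA] idem
    by (simp only: right_mult_one_mat[OF BA])
  moreover have "E * E = E - B * A * E"
    using minus_mult_distrib_mat[OF one_carrier_mat BA E]
    by (simp only: E_def[symmetric] left_mult_one_mat[OF E])
  ultimately have "E * E = E" using E BA by (auto intro!: eq_matI)
  then have "E = E * (E * E)" by simp
  also have "\<dots> = 0\<^sub>m n n"
  proof (intro eq_matI)
    fix i j assume "i < dim_row (0\<^sub>m n n :: 'a mat)" "j < dim_col (0\<^sub>m n n :: 'a mat)"
    then have ij: "i < n" "j < n" by simp_all
    have "(E * (E * E)) $$ (i, j) = (\<Sum>k<n. E $$ (i, k) * (\<Sum>l<n. E $$ (k, l) * E $$ (l, j)))"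
      using E ij by (simp add: scalar_prod_def atLeast0LessThan)
    also have "\<dots> = (\<Sum>k<n. \<Sum>l<n. E $$ (i, k) * E $$ (k, l) * E $$ (l, j))"
      by (simp add: sum_distrib_left mult.assoc)
    also have "\<dots> = 0"
      using ij hE by (intro sum.neutral ballI ker) auto
    finally show "(E * (E * E)) $$ (i, j) = 0\<^sub>m n n $$ (i, j)" using ij by simp
  qed (use E in auto)
  finally have E0: "E = 0\<^sub>m n n" .
  have "(B * A) $$ (i, j) = 1\<^sub>m n $$ (i, j)" if "i < n" "j < n" for i j
    using arg_cong[OF E0, of "\<lambda>M. M $$ (i, j)"] that A B by (auto simp: E_def simp del: index_mult_mat(1))
  then show ?thesis using A B by (intro eq_matI) auto
qed

section \<open>Transporting a type-class algebra\<close>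

text \<open>
  Carrying the operations of a type-class ring along an injection keeps all calculations in the
  type class, where the simplifier and the matrix library apply directly.
\<close>

definition transported_algebra :: "('a::ring_1 \<Rightarrow> 'b) \<Rightarrow> ('f \<Rightarrow> 'a \<Rightarrow> 'a) \<Rightarrow> ('f, 'b) module" where
  "transported_algebra \<iota> s =
     \<lparr>carrier = range \<iota>, monoid.mult = (\<lambda>x y. \<iota> (inv_into UNIV \<iota> x * inv_into UNIV \<iota> y)), one = \<iota> 1, zero = \<iota> 0,
      add = (\<lambda>x y. \<iota> (inv_into UNIV \<iota> x + inv_into UNIV \<iota> y)), smult = (\<lambda>c x. \<iota> (s c (inv_into UNIV \<iota> x)))\<rparr>"

locale algebra_transport =
  fixes \<iota> :: "'a::ring_1 \<Rightarrow> 'b" and s :: "'f::field \<Rightarrow> 'a \<Rightarrow> 'a"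
  assumes inj: "inj \<iota>"
    and s_add_right: "s c (x + y) = s c x + s c y"
    and s_add_left: "s (c + d) x = s c x + s d x"
    and s_s: "s (c * d) x = s c (s d x)"
    and s_1: "s 1 x = x"
    and s_mult_left: "s c x * y = s c (x * y)"
    and s_mult_right: "x * s c y = s c (x * y)"
begin

abbreviation \<kappa> where "\<kappa> \<equiv> inv_into UNIV \<iota>"

abbreviation A where "A \<equiv> transported_algebra \<iota> s"

lemma inv_transport [simp]: "\<kappa> (\<iota> x) = x"
  using inj by (rule inv_f_f)

lemma A_simps [simp]:
  "carrier A = range \<iota>"
  "\<iota> x \<otimes>\<^bsub>A\<^esub> \<iota> y = \<iota> (x * y)" "\<iota> x \<oplus>\<^bsub>A\<^esub> \<iota> y = \<iota> (x + y)" "c \<odot>\<^bsub>A\<^esub> \<iota> x = \<iota> (s c x)"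
  "\<one>\<^bsub>A\<^esub> = \<iota> 1" "\<zero>\<^bsub>A\<^esub> = \<iota> 0"
  by (simp_all add: transported_algebra_def)

lemma assoc_algebra_transport: "assoc_algebra A"
proof -
  have grp: "abelian_group A"
  proof (rule abelian_groupI)
    fix x assume "x \<in> carrier A"
    then obtain a where "x = \<iota> a" by auto
    then show "\<exists>y\<in>carrier A. y \<oplus>\<^bsub>A\<^esub> x = \<zero>\<^bsub>A\<^esub>" by (intro bexI[of _ "\<iota> (- a)"]) simp_all
  qed (auto simp: algebra_simps)
  have "ring A"
    by (rule ringI[OF grp]) (auto simp: algebra_simps intro!: monoidI)
  moreover have "Module.module (class_ring :: 'f ring) A"
    by (rule Module.moduleI[OF _ grp])
      (auto simp: s_add_left s_add_right s_s s_1 intro: class_cring.cring_axioms)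
  ultimately show ?thesis
    unfolding assoc_algebra_def assoc_algebra_axioms_def
    by (auto simp: s_mult_left s_mult_right)
qed

lemma finsum_transport: "finite S \<Longrightarrow> (\<Oplus>\<^bsub>A\<^esub>i\<in>S. \<iota> (f i)) = \<iota> (\<Sum>i\<in>S. f i)"
proof (induction S rule: finite_induct)
  interpret assoc_algebra A by (rule assoc_algebra_transport)
  case empty
  then show ?case by simp
next
  interpret assoc_algebra A by (rule assoc_algebra_transport)
  case (insert i S)
  then show ?case by (subst finsum_insert) auto
qed

lemma stably_finite_transport:
  assumes df: "\<And>n (X::'a mat) Y. X \<in> carrier_mat n n \<Longrightarrow> Y \<in> carrier_mat n n
    \<Longrightarrow> X * Y = 1\<^sub>m n \<Longrightarrow> Y * X = 1\<^sub>m n"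
  shows "stably_finite A"
  unfolding stably_finite_def directly_finite_def
proof (intro allI ballI impI)
  fix n X Y
  assume X: "X \<in> carrier (matrix_ring n A)" and Y: "Y \<in> carrier (matrix_ring n A)"
    and XY: "X \<otimes>\<^bsub>matrix_ring n A\<^esub> Y = \<one>\<^bsub>matrix_ring n A\<^esub>"
  have mult: "map_mat \<iota> P \<otimes>\<^bsub>matrix_ring n A\<^esub> map_mat \<iota> Q = map_mat \<iota> (P * Q)"
    if "P \<in> carrier_mat n n" "Q \<in> carrier_mat n n" for P Q
  proof -
    interpret assoc_algebra A by (rule assoc_algebra_transport)
    have "(\<Oplus>\<^bsub>A\<^esub>k\<in>{..<n}. map_mat \<iota> P $$ (i, k) \<otimes>\<^bsub>A\<^esub> map_mat \<iota> Q $$ (k, j))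
        = (\<Oplus>\<^bsub>A\<^esub>k\<in>{..<n}. \<iota> (P $$ (i, k) * Q $$ (k, j)))" if "i < n" "j < n" for i j
      using that \<open>P \<in> carrier_mat n n\<close> \<open>Q \<in> carrier_mat n n\<close> by (intro finsum_cong') auto
    then show ?thesis
      using that
      by (intro eq_matI)
        (auto simp: matrix_ring_def finsum_transport scalar_prod_def atLeast0LessThan)
  qed
  have one: "\<one>\<^bsub>matrix_ring n A\<^esub> = map_mat \<iota> (1\<^sub>m n)"
    by (intro eq_matI) (auto simp: matrix_ring_def)
  have lift: "\<exists>P \<in> carrier_mat n n. Z = map_mat \<iota> P" if Z: "Z \<in> carrier (matrix_ring n A)" for Z
  proof
    show "map_mat \<kappa> Z \<in> carrier_mat n n" using Z by (auto simp: matrix_ring_def)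
    show "Z = map_mat \<iota> (map_mat \<kappa> Z)"
    proof (rule eq_matI)
      fix i j
      assume "i < dim_row (map_mat \<iota> (map_mat \<kappa> Z))" "j < dim_col (map_mat \<iota> (map_mat \<kappa> Z))"
      then have ij: "i < dim_row Z" "j < dim_col Z" by auto
      then have "Z $$ (i, j) \<in> range \<iota>" using Z by (force simp: matrix_ring_def elements_mat_def)
      then show "Z $$ (i, j) = map_mat \<iota> (map_mat \<kappa> Z) $$ (i, j)"
        using ij by auto
    qed auto
  qed
  have inj_map: "P = Q" if "map_mat \<iota> P = map_mat \<iota> Q" for P Q :: "'a mat"
  proof -
    have "map_mat \<kappa> (map_mat \<iota> P) = map_mat \<kappa> (map_mat \<iota> Q)" using that by simp
    moreover have "map_mat \<kappa> (map_mat \<iota> R) = R" for R by (intro eq_matI) auto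
    ultimately show ?thesis by simp
  qed
  obtain P Q where P: "P \<in> carrier_mat n n" "X = map_mat \<iota> P"
    and Q: "Q \<in> carrier_mat n n" "Y = map_mat \<iota> Q" using lift X Y by blast
  have "P * Q = 1\<^sub>m n" using XY P Q by (intro inj_map) (simp add: mult one)
  then have "Q * P = 1\<^sub>m n" using df P Q by blast
  then show "Y \<otimes>\<^bsub>matrix_ring n A\<^esub> X = \<one>\<^bsub>matrix_ring n A\<^esub>" using P Q by (simp add: mult one)
qed

lemma eval_word_transport:
  assumes "w \<in> lists V" "\<And>i. i \<in> V \<Longrightarrow> a i = \<iota> (b i)"
  shows "eval_word A a w = \<iota> (prod_list (map b w))"
  using assms by (induction w) (auto simp: eval_word_def)

lemma eval_poly_transport:
  assumes f: "Poly_Mapping.keys f \<subseteq> S" "finite S" "S \<subseteq> lists V"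
    and a: "\<And>i. i \<in> V \<Longrightarrow> a i = \<iota> (b i)"
  shows "eval_poly A f a = \<iota> (\<Sum>w\<in>S. s (Poly_Mapping.lookup f w) (prod_list (map b w)))"
proof -
  have s0: "s 0 x = 0" for x using s_add_left[of 0 0 x] by simp
  have "eval_poly A f a
      = (\<Oplus>\<^bsub>A\<^esub>w\<in>Poly_Mapping.keys f. \<iota> (s (Poly_Mapping.lookup f w) (prod_list (map b w))))"
  proof -
    interpret assoc_algebra A by (rule assoc_algebra_transport)
    show ?thesis
      unfolding eval_poly_def
      using f(1,3) a by (intro finsum_cong') (auto simp: eval_word_transport[where V = V and b = b] subset_iff)
  qed
  also have "\<dots> = \<iota> (\<Sum>w\<in>Poly_Mapping.keys f. s (Poly_Mapping.lookup f w) (prod_list (map b w)))"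
    by (rule finsum_transport) simp
  also have "\<dots> = \<iota> (\<Sum>w\<in>S. s (Poly_Mapping.lookup f w) (prod_list (map b w)))"
    using f by (intro arg_cong[of _ _ \<iota>] sum.mono_neutral_left) (auto simp: in_keys_iff s0)
  finally show ?thesis .
qed

text \<open>
  The identity is the cube of the commutator of two variables, written out as eight signed words.
\<close>

lemma satisfies_polynomial_identity_transport:
  assumes comm: "\<And>x y :: 'a. (x * y - y * x) * (x * y - y * x) * (x * y - y * x) = 0"
  shows "satisfies_polynomial_identity A"
proof -
  define f :: "nat list \<Rightarrow>\<^sub>0 'f" where
    "f = Poly_Mapping.single [0,1,0,1,0,1] 1 - Poly_Mapping.single [0,1,0,1,1,0] 1
       - Poly_Mapping.single [0,1,1,0,0,1] 1 + Poly_Mapping.single [0,1,1,0,1,0] 1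
       - Poly_Mapping.single [1,0,0,1,0,1] 1 + Poly_Mapping.single [1,0,0,1,1,0] 1
       + Poly_Mapping.single [1,0,1,0,0,1] 1 - Poly_Mapping.single [1,0,1,0,1,0] 1"
  let ?S = "{[0,1,0,1,0,1], [0,1,0,1,1,0], [0,1,1,0,0,1], [0,1,1,0,1,0], [1,0,0,1,0,1],
    [1,0,0,1,1,0], [1,0,1,0,0,1], [1,0,1,0,1,0]} :: nat list set"
  have lookup: "Poly_Mapping.lookup f w =
      (if w = [0,1,0,1,0,1] then 1 else 0) - (if w = [0,1,0,1,1,0] then 1 else 0)
      - (if w = [0,1,1,0,0,1] then 1 else 0) + (if w = [0,1,1,0,1,0] then 1 else 0)
      - (if w = [1,0,0,1,0,1] then 1 else 0) + (if w = [1,0,0,1,1,0] then 1 else 0)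
      + (if w = [1,0,1,0,0,1] then 1 else 0) - (if w = [1,0,1,0,1,0] then 1 else 0)" for w
    unfolding f_def by (simp add: lookup_add lookup_minus lookup_single when_def eq_commute)
  have keys: "Poly_Mapping.keys f \<subseteq> ?S"
    by (rule subsetI, rule ccontr) (simp add: in_keys_iff lookup)
  have "Poly_Mapping.lookup f [0,1,0,1,0,1] \<noteq> 0" unfolding lookup by simp
  then have "f \<noteq> 0" by auto
  moreover have "f \<in> free_algebra_polys 2"
    using keys by (force simp: free_algebra_polys_def)
  moreover have "eval_poly A f a = \<zero>\<^bsub>A\<^esub>" if a: "a \<in> {..<2} \<rightarrow> carrier A" for a
  proof -
    have s_uminus: "s (- 1) x = - x" for x
      using s_add_left[of 1 "- 1" x] s_add_left[of 0 0 x] by (simp add: s_1 add_eq_0_iff)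
    have a': "a i = \<iota> (\<kappa> (a i))" if "i \<in> {0, 1}" for i
      using a that by (auto simp: Pi_iff f_inv_into_f)
    let ?x = "\<kappa> (a 0)" and ?y = "\<kappa> (a 1)"
    have "eval_poly A f a
        = \<iota> (\<Sum>w\<in>?S. s (Poly_Mapping.lookup f w) (prod_list (map (\<lambda>i. \<kappa> (a i)) w)))"
      by (rule eval_poly_transport[where V = "{0, 1}"]) (use keys a' in auto)
    also have "(\<Sum>w\<in>?S. s (Poly_Mapping.lookup f w) (prod_list (map (\<lambda>i. \<kappa> (a i)) w)))
        = (?x * ?y - ?y * ?x) * (?x * ?y - ?y * ?x) * (?x * ?y - ?y * ?x)"
      by (simp add: lookup s_1 s_uminus algebra_simps)
    finally show ?thesis by (simp add: comm)
  qed
  ultimately show ?thesis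
    unfolding satisfies_polynomial_identity_def by (intro exI[of _ 2] conjI bexI[of _ f]) auto
qed

end

section \<open>Triangular matrices with a Hankel corner\<close>

text \<open>
  The linear functional on polynomials that sends the monomial of degree \<open>N\<close> to 1 if \<open>N\<close> is a square
  and to 0 otherwise. Cutting the sum off at the degree loses nothing because \<open>k \<le> k\<^sup>2\<close>.
\<close>

definition square_coeff_sum :: "'a::comm_ring_1 poly \<Rightarrow> 'a" where
  "square_coeff_sum p = (\<Sum>k\<le>degree p. coeff p (k\<^sup>2))"

lemma square_coeff_sum_eq:
  assumes "degree p \<le> N"
  shows "square_coeff_sum p = (\<Sum>k\<le>N. coeff p (k\<^sup>2))"
  unfolding square_coeff_sum_def
proof (rule sum.mono_neutral_left)
  show "\<forall>k\<in>{..N} - {..degree p}. coeff p (k\<^sup>2) = 0"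
  proof
    fix k assume "k \<in> {..N} - {..degree p}"
    then have "degree p < k\<^sup>2" by (auto simp: power2_eq_square intro: less_le_trans[OF _ le_square])
    then show "coeff p (k\<^sup>2) = 0" by (rule coeff_eq_0)
  qed
qed (use assms in auto)

lemma square_coeff_sum_add: "square_coeff_sum (p + q) = square_coeff_sum p + square_coeff_sum q"
proof -
  let ?N = "max (degree p) (degree q)"
  have "degree (p + q) \<le> ?N" by (rule degree_add_le_max)
  then show ?thesis
    by (simp add: square_coeff_sum_eq[of _ ?N] sum.distrib)
qed

lemma square_coeff_sum_smult: "square_coeff_sum (Polynomial.smult c p) = c * square_coeff_sum p"
  using square_coeff_sum_eq[of "Polynomial.smult c p" "degree p"]
  by (simp add: square_coeff_sum_def sum_distrib_left degree_smult_le)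

lemma square_coeff_sum_0: "square_coeff_sum 0 = 0"
  by (simp add: square_coeff_sum_def)

lemma square_coeff_sum_monom:
  "square_coeff_sum (monom c N) = (if \<exists>k. N = k\<^sup>2 then c else 0)"
proof (cases "\<exists>k. N = k\<^sup>2")
  case True
  then obtain m where m: "N = m\<^sup>2" by blast
  then have "m \<le> N" by (simp add: power2_eq_square)
  have "square_coeff_sum (monom c N) = (\<Sum>k\<le>N. if m = k then c else 0)"
    by (subst square_coeff_sum_eq[OF degree_monom_le])
      (auto simp: m power2_eq_iff_nonneg intro!: sum.cong)
  then show ?thesis using True \<open>m \<le> N\<close> by simp
next
  case False
  then show ?thesis by (subst square_coeff_sum_eq[OF degree_monom_le]) (auto intro!: sum.neutral)
qed

text \<open>
  \<open>Hankel_Triangular p q r c\<close> stands for the upper triangular matrix with rows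
  \<open>p(0), q, c\<close> and \<open>0, p, r\<close> and \<open>0, 0, p(0)\<close>, multiplied as matrices except that a product \<open>q * r\<close>
  arriving in the corner is replaced by its image under \<^const>\<open>square_coeff_sum\<close>. The outer diagonal
  entries make \<open>x u\<close> and \<open>v x\<close> vanish, where \<open>x\<close>, \<open>u\<close>, \<open>v\<close> have the polynomial \<open>X\<close> on the diagonal, 1 in
  the row and 1 in the column, and are zero elsewhere. Multiplication is associative because that
  functional is linear and only sees the product \<open>q * p * r\<close>.
\<close>

declare [[typedef_overloaded]]

datatype 'a hankel_triangular =
  Hankel_Triangular (diag: "'a poly") (row_part: "'a poly") (col_part: "'a poly") (corner: 'a)

instantiation hankel_triangular :: (comm_ring_1) ring_1
begin

definition "0 = Hankel_Triangular 0 0 0 0"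
definition "1 = Hankel_Triangular 1 0 0 0"
definition "A + B = Hankel_Triangular (diag A + diag B) (row_part A + row_part B)
  (col_part A + col_part B) (corner A + corner B)"
definition "A - B = Hankel_Triangular (diag A - diag B) (row_part A - row_part B)
  (col_part A - col_part B) (corner A - corner B)"
definition "- A = Hankel_Triangular (- diag A) (- row_part A) (- col_part A) (- corner A)"
definition "A * B = Hankel_Triangular (diag A * diag B)
  (Polynomial.smult (coeff (diag A) 0) (row_part B) + row_part A * diag B)
  (diag A * col_part B + Polynomial.smult (coeff (diag B) 0) (col_part A))
  (coeff (diag A) 0 * corner B + corner A * coeff (diag B) 0
    + square_coeff_sum (row_part A * col_part B))"

lemmas hankel_triangular_defs = zero_hankel_triangular_def one_hankel_triangular_def
  plus_hankel_triangular_def minus_hankel_triangular_def uminus_hankel_triangular_def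
  times_hankel_triangular_def

instance
  by standard
    (auto simp: hankel_triangular_defs algebra_simps smult_add_right smult_add_left
      coeff_mult square_coeff_sum_add square_coeff_sum_smult square_coeff_sum_0)

end

definition hankel_scale :: "'a::comm_ring_1 \<Rightarrow> 'a hankel_triangular \<Rightarrow> 'a hankel_triangular" where
  "hankel_scale c A = Hankel_Triangular (Polynomial.smult c (diag A)) (Polynomial.smult c (row_part A))
    (Polynomial.smult c (col_part A)) (c * corner A)"

text \<open>
  An injection into coefficient functions on words. The length of the word selects the component
  and its first letter the coefficient.
\<close>

fun hankel_coords :: "'a::comm_ring_1 hankel_triangular \<Rightarrow> nat list \<Rightarrow> 'a" where
  "hankel_coords A [] = corner A"
| "hankel_coords A [k] = coeff (diag A) k"
| "hankel_coords A [k, _] = coeff (row_part A) k"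
| "hankel_coords A (k # _) = coeff (col_part A) k"

lemma inj_hankel_coords: "inj hankel_coords"
proof (rule injI)
  fix A B :: "'a hankel_triangular" assume "hankel_coords A = hankel_coords B"
  then have eq: "hankel_coords A w = hankel_coords B w" for w by simp
  show "A = B"
  proof (rule hankel_triangular.expand, intro conjI)
    show "corner A = corner B" using eq[of "[]"] by simp
    show "diag A = diag B" using eq[of "[_]"] by (simp add: poly_eq_iff)
    show "row_part A = row_part B" using eq[of "[_, 0]"] by (simp add: poly_eq_iff)
    show "col_part A = col_part B" using eq[of "[_, 0, 0]"] by (simp add: poly_eq_iff)
  qed
qed

lemma Hankel_Triangular_mult:
  "Hankel_Triangular p q r c * Hankel_Triangular p' q' r' c' = Hankel_Triangular (p * p')
    (Polynomial.smult (coeff p 0) q' + q * p') (p * r' + Polynomial.smult (coeff p' 0) r)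
    (coeff p 0 * c' + c * coeff p' 0 + square_coeff_sum (q * r'))"
  by (simp add: times_hankel_triangular_def)

interpretation hankel: algebra_transport
  "hankel_coords :: 'f::field hankel_triangular \<Rightarrow> nat list \<Rightarrow> 'f" hankel_scale
proof
  show "inj (hankel_coords :: 'f hankel_triangular \<Rightarrow> nat list \<Rightarrow> 'f)" by (rule inj_hankel_coords)
qed (auto simp: hankel_scale_def hankel_triangular_defs algebra_simps smult_add_left
    smult_add_right square_coeff_sum_add square_coeff_sum_smult square_coeff_sum_0)

lemma diag_ring_hom: "Ring_Hom.ring_hom (diag :: 'a::comm_ring_1 hankel_triangular \<Rightarrow> 'a poly)"
  by standard (simp_all add: hankel_triangular_defs)

text \<open>
  Two elements with zero diagonal multiply into the corner, which they annihilate.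
\<close>

lemma diag_kernel_cube:
  assumes "diag x = 0" "diag y = 0" "diag z = 0"
  shows "x * y * z = 0"
  using assms by (simp add: hankel_triangular_defs square_coeff_sum_0)

text \<open>
  The generators are \<open>x\<close>, \<open>u\<close> and \<open>v\<close>. Words \<open>u x\<^sup>k\<close> and
  \<open>x\<^sup>k v\<close> fill the row and the column, and \<open>u v\<close> is the corner unit because 0 is a square.
\<close>

lemma generate_hankel:
  shows "generate_algebra (hankel.A :: ('f::field, nat list \<Rightarrow> 'f) module)
    (hankel_coords ` {Hankel_Triangular [:0, 1:] 0 0 0,
      Hankel_Triangular 0 1 0 0, Hankel_Triangular 0 0 1 0}) = range hankel_coords"
    (is "generate_algebra ?A (hankel_coords ` ?S) = _")
proof (intro equalityI subsetI)
  fix x assume "x \<in> generate_algebra ?A (hankel_coords ` ?S)"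
  then show "x \<in> range hankel_coords"
    by (induction rule: generate_algebra.induct) auto
next
  let ?G = "{x. hankel_coords x \<in> generate_algebra ?A (hankel_coords ` ?S)}"
  have G: "1 \<in> ?G" "x \<in> ?S \<Longrightarrow> x \<in> ?G" "x \<in> ?G \<Longrightarrow> y \<in> ?G \<Longrightarrow> x + y \<in> ?G"
    "x \<in> ?G \<Longrightarrow> y \<in> ?G \<Longrightarrow> x * y \<in> ?G" "x \<in> ?G \<Longrightarrow> hankel_scale c x \<in> ?G" for x y c
    using generate_algebra.one[where A = ?A and S = "hankel_coords ` ?S"]
      generate_algebra.incl[of "hankel_coords x" "hankel_coords ` ?S" ?A]
      generate_algebra.add[where A = ?A and x = "hankel_coords x" and y = "hankel_coords y"]
      generate_algebra.mult[where A = ?A and x = "hankel_coords x" and y = "hankel_coords y"]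
      generate_algebra.smult[where A = ?A and x = "hankel_coords x" and c = c]
    by auto
  have p: "Hankel_Triangular p 0 0 0 \<in> ?G" for p
  proof (induction p)
    case 0
    have "Hankel_Triangular 0 0 0 0 = hankel_scale 0 (1 :: 'f hankel_triangular)"
      by (simp add: hankel_scale_def one_hankel_triangular_def)
    then show ?case using G(5)[OF G(1), of 0] by (simp only:)
  next
    case (pCons a p)
    have "Hankel_Triangular (pCons a p) 0 0 0
        = hankel_scale a 1 + Hankel_Triangular [:0, 1:] 0 0 0 * Hankel_Triangular p 0 0 0"
      by (simp add: hankel_triangular_defs hankel_scale_def square_coeff_sum_0)
    then show ?case using G pCons by (metis insertI1)
  qed
  have u: "Hankel_Triangular 0 1 0 0 \<in> ?G" and v: "Hankel_Triangular 0 0 1 0 \<in> ?G"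
    by (intro G(2); simp)+
  fix y assume "y \<in> range (hankel_coords :: 'f hankel_triangular \<Rightarrow> _)"
  then obtain p q r c where y: "y = hankel_coords (Hankel_Triangular p q r c)"
    by (metis rangeE hankel_triangular.exhaust)
  have "Hankel_Triangular p q r c = Hankel_Triangular p 0 0 0
      + Hankel_Triangular 0 1 0 0 * Hankel_Triangular q 0 0 0
      + Hankel_Triangular r 0 0 0 * Hankel_Triangular 0 0 1 0
      + hankel_scale c (Hankel_Triangular 0 1 0 0 * Hankel_Triangular 0 0 1 0)"
    using square_coeff_sum_monom[of "1 :: 'f" 0]
    by (simp add: hankel_triangular_defs hankel_scale_def square_coeff_sum_0)
  also have "\<dots> \<in> ?G" by (intro G(3) G(4) G(5) p u v)
  finally show "y \<in> generate_algebra ?A (hankel_coords ` ?S)" using y by simp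
qed

text \<open>
  The square after \<open>d\<^sup>2\<close> is \<open>d\<^sup>2 + 2 d + 1\<close>.
\<close>

lemma not_square_between:
  assumes "0 < i" "i < (d::nat)"
  shows "\<nexists>k. d\<^sup>2 + i = k\<^sup>2"
proof
  assume "\<exists>k. d\<^sup>2 + i = k\<^sup>2"
  then obtain k where k: "d\<^sup>2 + i = k\<^sup>2" ..
  have "d\<^sup>2 < k\<^sup>2" using assms(1) k by linarith
  moreover have "k\<^sup>2 < (Suc d)\<^sup>2" using assms(2) unfolding k[symmetric] by (simp add: power2_eq_square)
  ultimately have "d < k" "k < Suc d" using power2_less_imp_less[of d k] power2_less_imp_less[of k "Suc d"] by simp_all
  then show False by simp
qed

theorem theorem1p2:
  shows "\<exists>A :: ('f::field, nat list \<Rightarrow> 'f) module.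
           assoc_algebra A \<and> finitely_generated_algebra A \<and>
           \<not> linear_sofic A \<and> satisfies_polynomial_identity A \<and> stably_finite A"
proof (intro exI conjI)
  let ?A = "hankel.A :: ('f, nat list \<Rightarrow> 'f) module"
  show A: "assoc_algebra ?A" by (rule hankel.assoc_algebra_transport)
  show "finitely_generated_algebra ?A"
    unfolding finitely_generated_algebra_def
    by (rule exI[of _ "hankel_coords ` {Hankel_Triangular [:0, 1:] 0 0 0,
      Hankel_Triangular 0 1 0 0, Hankel_Triangular 0 0 1 0}"]) (use generate_hankel in auto)
  show "satisfies_polynomial_identity ?A"
  proof (rule hankel.satisfies_polynomial_identity_transport, rule diag_kernel_cube)
    fix x y :: "'f hankel_triangular"
    show "diag (x * y - y * x) = 0" "diag (x * y - y * x) = 0" "diag (x * y - y * x) = 0"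
      by (simp_all add: hankel_triangular_defs mult.commute)
  qed
  show "stably_finite ?A"
    using right_inverse_imp_left_inverse_mat_nilpotent_kernel[OF diag_ring_hom diag_kernel_cube]
    by (rule hankel.stably_finite_transport)
  show "\<not> linear_sofic ?A"
  proof (rule not_linear_sofic_if_matrix_units[OF A])
    \<comment> \<open>The product \<open>u x\<^sup>i\<close> times \<open>x\<^sup>e v\<close> with \<open>e = d\<^sup>2 - j\<close> is \<open>m\<close> if \<open>d\<^sup>2 + i - j\<close> is a square and 0 otherwise.\<close>
    let ?m = "Hankel_Triangular 0 0 0 1 :: 'f hankel_triangular"
    let ?u = "\<lambda>i. Hankel_Triangular 0 (monom 1 i) 0 0 :: 'f hankel_triangular"
    let ?v = "\<lambda>d j. Hankel_Triangular 0 0 (monom 1 (d\<^sup>2 - j)) 0 :: 'f hankel_triangular"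
    show "hankel_coords ?m \<in> carrier ?A" by simp
    show "hankel_coords ?m \<noteq> \<zero>\<^bsub>?A\<^esub>"
      by (simp add: inj_eq[OF inj_hankel_coords] zero_hankel_triangular_def)
    fix d i j :: nat
    show "hankel_coords (?u i) \<in> carrier ?A" "hankel_coords (?v d i) \<in> carrier ?A" by simp_all
    assume i: "i < d"
    have d: "d \<le> d\<^sup>2" by (simp add: power2_eq_square)
    have uv: "?u i * ?v d j = Hankel_Triangular 0 0 0 (if \<exists>k. i + (d\<^sup>2 - j) = k\<^sup>2 then 1 else 0)"
      for j by (simp add: Hankel_Triangular_mult mult_monom square_coeff_sum_monom)
    have "i + (d\<^sup>2 - i) = d\<^sup>2" using i d by simp
    then show "hankel_coords (?u i) \<otimes>\<^bsub>?A\<^esub> hankel_coords (?v d i) = hankel_coords ?m"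
      by (auto simp: uv)
    assume j: "j < i"
    have "i + (d\<^sup>2 - j) = d\<^sup>2 + (i - j)" using i j d by simp
    then show "hankel_coords (?u i) \<otimes>\<^bsub>?A\<^esub> hankel_coords (?v d j) = \<zero>\<^bsub>?A\<^esub>"
      using not_square_between[of "i - j" d] i j by (simp add: uv zero_hankel_triangular_def)
  qed
qed

end
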